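(* Let $X$ be a real Banach space, $B_n \in \mathscr{L}(X)$ for $n \in \{0,1,2,\ldots\}$, and for each $n\ge 0$ let $I_n^-, I_n^+ : X \to [0,\infty)$ be continuous homogeneous (not necessarily linear) functionals. Assume that there exist $c_1>0$, $c_2>0$, $K\in\{0,1,2,\ldots\}$, $\alpha_{k,n}^+\in X^*$ for $(k,n)\in\{1,\ldots,K\}\times\{0,1,\ldots\}$, $c_3,c_4>0$ and $0<a<b<\infty$ such that for all $n\ge 0$: \begin{enumerate} \item $c_1\|v\|_X \le I_n^-(v)+I_n^+(v)\le \frac{1}{c_1}\|v\|_X$ for all $v\in X$; \item $c_2\max_{1\le k\le K}|\langle \alpha_{k,n}^+,v\rangle| \le I_n^+(v)\le \frac{1}{c_2}\max_{1\le k\le K}|\langle \alpha_{k,n}^+,v\rangle|$ for all $v\in X$; \item $\mathcal{V}_{\mathrm u}(c_3,n)$ contains a linear space of dimension $K$; \item $c_4<\frac13 (c_1c_2)^2\frac{c_3}{1+c_3}$; \item $I_{n+1}^-(B_nv_n)\le a\,I_n^-(v_n)$ for every $v_n\in X$ such that $B_nv_n\in\mathcal{V}_{\mathrm s}(c_3,n+1)$; \item $I_{n+1}^+(B_nv_n)\ge b\,I_n^+(v_n)$ for every $v_n\in \mathcal{V}_{\mathrm u}(c_4,n)$. \end{enumerate} Then the system $v_{n+1}=B_nv_n$, $v_0\in X$, has an exponential dichotomy with values $a$ and $b$. For all $n\ge0$ the stable subspace $X_{\mathrm s}(n)$ is contained in $\mathcal{V}_{\mathrm s}(c_4,n)$ and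 has codimension $K$.
   Context: $\mathscr{L}(X)$ denotes bounded linear operators on $X$. Homogeneous means $I(\lambda v)=|\lambda| I(v)$ for $\lambda\in\mathbb{R}$. A maximum over an empty index set is $0$. The sequence $(B_n)$ need not be bounded and $B_n$ need not be invertible. Cones: for $c>0$, $\mathcal{V}_{\mathrm s}(c,n):=\{v\in X: I_n^+(v)\le c I_n^-(v)\}$ and $\mathcal{V}_{\mathrm u}(c,n):=\{v\in X: I_n^+(v)\ge c I_n^-(v)\}$. For $n\le m$: $B(n,n):=\mathrm{Id}$, $B(m,n):=B_{m-1}B_{m-2}\cdots B_n$. Exponential dichotomy: the system $v_{n+1}=B_nv_n$ has an exponential dichotomy with values $a$ and $b$, $0<a<b$, if for all $n\ge 0$ there is a direct sum decomposition $X=X_{\mathrm s}(n)\oplus X_{\mathrm u}(n)$ with associated projections $\pi_{\mathrm s}(n):X\to X_{\mathrm s}(n)$, $\pi_{\mathrm u}(n):X\to X_{\mathrm u}(n)$ such that for some $C>0$ and all $n\le m$: (1) $B(m,n)\circ\pi_{\mathrm s}(n)=\pi_{\mathrm s}(m)\circ B(m,n)$ and $B(m,n)\circ\pi_{\mathrm u}(n)=\pi_{\mathrm u}(m)\circ B(m,n)$; (2) $\|\pi_{\mathrm s}(n)\|_{\mathscr{L}(X)}+\|\pi_{\mathrm u}(n)\|_{\mathscr{L}(X)}\le C$; (3) $B(m,n)|_{X_{\mathrm u}(n)}:X_{\mathrm u}(n)\to X_{\mathrm u}(m)$ is invertible; (4) $\|B(m,n)v_n\|\le Ca^{m-n}\|v_n\|$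 for all $v_n\in X_{\mathrm s}(n)$; (5) $\|B(m,n)^{-1}v_m\|\le Cb^{n-m}\|v_m\|$ for all $v_m\in X_{\mathrm u}(m)$, where $B(m,n)^{-1}$ is the inverse of the restriction in (3). $X_{\mathrm s}(n)$ is called the stable subspace; it is uniquely determined. *)

theory Defs
  imports "HOL-Analysis.Analysis"
begin

definition stable_cone ::
    "(nat \<Rightarrow> 'a \<Rightarrow> real) \<Rightarrow> (nat \<Rightarrow> 'a \<Rightarrow> real) \<Rightarrow> real \<Rightarrow> nat \<Rightarrow> 'a set" where
  "stable_cone Iminus Iplus c n = {v. Iplus n v \<le> c * Iminus n v}"

definition unstable_cone ::
    "(nat \<Rightarrow> 'a \<Rightarrow> real) \<Rightarrow> (nat \<Rightarrow> 'a \<Rightarrow> real) \<Rightarrow> real \<Rightarrow> nat \<Rightarrow> 'a set" where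
  "unstable_cone Iminus Iplus c n = {v. Iplus n v \<ge> c * Iminus n v}"

definition homogeneous :: "('a::real_vector \<Rightarrow> real) \<Rightarrow> bool" where
  "homogeneous I \<longleftrightarrow> (\<forall>r v. I (r *\<^sub>R v) = \<bar>r\<bar> * I v)"

definition max_functional ::
    "nat \<Rightarrow> (nat \<Rightarrow> nat \<Rightarrow> 'a::real_normed_vector \<Rightarrow>\<^sub>L real) \<Rightarrow> nat \<Rightarrow> 'a \<Rightarrow> real" where
  "max_functional K \<alpha> n v =
     (if K = 0 then 0 else Max ((\<lambda>k. \<bar>blinfun_apply (\<alpha> k n) v\<bar>) ` {1..K}))"

text \<open>The library's \<open>dim\<close> is 0 on infinite-dimensional spaces, so a finite spanning set
  is required explicitly.\<close>
definition has_dimension :: "'a::real_vector set \<Rightarrow> nat \<Rightarrow> bool" where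
  "has_dimension S K \<longleftrightarrow> (\<exists>A. finite A \<and> span A = S) \<and> dim S = K"

definition direct_sum_decomp :: "'a::real_vector set \<Rightarrow> 'a set \<Rightarrow> bool" where
  "direct_sum_decomp S T \<longleftrightarrow>
     subspace S \<and> subspace T \<and> S \<inter> T = {0} \<and> (\<forall>v. \<exists>s\<in>S. \<exists>t\<in>T. v = s + t)"

text \<open>Codimension as the dimension of an algebraic complement; every complement of \<open>S\<close>
  is isomorphic to the quotient of the whole space by \<open>S\<close>.\<close>
definition has_codimension :: "'a::real_vector set \<Rightarrow> nat \<Rightarrow> bool" where
  "has_codimension S K \<longleftrightarrow> (\<exists>T. direct_sum_decomp S T \<and> has_dimension T K)"

text \<open>\<open>evol B m n\<close> is the product of \<open>B (m - 1)\<close> down to \<open>B n\<close> for \<open>n \<le> m\<close>.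
  The value for \<open>m < n\<close> is irrelevant.\<close>
primrec evol ::
    "(nat \<Rightarrow> 'a::real_normed_vector \<Rightarrow>\<^sub>L 'a) \<Rightarrow> nat \<Rightarrow> nat \<Rightarrow> 'a \<Rightarrow>\<^sub>L 'a" where
  "evol B 0 n = id_blinfun"
| "evol B (Suc m) n = (if n \<le> m then B m o\<^sub>L evol B m n else id_blinfun)"

text \<open>\<open>Ps n\<close> and \<open>Pu n\<close> are the projections onto \<open>Xs n\<close> along \<open>Xu n\<close> and vice versa.
  They are determined by the decomposition, and typing them as bounded operators is no
  extra requirement in view of the norm bound.\<close>
definition exp_dichotomy ::
    "(nat \<Rightarrow> 'a::real_normed_vector \<Rightarrow>\<^sub>L 'a) \<Rightarrow> real \<Rightarrow> real \<Rightarrow>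
     (nat \<Rightarrow> 'a set) \<Rightarrow> (nat \<Rightarrow> 'a set) \<Rightarrow> bool" where
  "exp_dichotomy B a b Xs Xu \<longleftrightarrow>
     0 < a \<and> a < b \<and>
     (\<forall>n. direct_sum_decomp (Xs n) (Xu n)) \<and>
     (\<exists>(Ps :: nat \<Rightarrow> 'a \<Rightarrow>\<^sub>L 'a) (Pu :: nat \<Rightarrow> 'a \<Rightarrow>\<^sub>L 'a).
        (\<forall>n v. blinfun_apply (Ps n) v \<in> Xs n \<and> blinfun_apply (Pu n) v \<in> Xu n \<and>
               v = blinfun_apply (Ps n) v + blinfun_apply (Pu n) v) \<and>
        (\<exists>C>0.
           (\<forall>n m. n \<le> m \<longrightarrow>
              evol B m n o\<^sub>L Ps n = Ps m o\<^sub>L evol B m n \<and>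
              evol B m n o\<^sub>L Pu n = Pu m o\<^sub>L evol B m n) \<and>
           (\<forall>n. norm (Ps n) + norm (Pu n) \<le> C) \<and>
           (\<forall>n m. n \<le> m \<longrightarrow> bij_betw (evol B m n) (Xu n) (Xu m)) \<and>
           (\<forall>n m. n \<le> m \<longrightarrow>
              (\<forall>v\<in>Xs n. norm (evol B m n v) \<le> C * a ^ (m - n) * norm v)) \<and>
           (\<forall>n m. n \<le> m \<longrightarrow>
              (\<forall>v\<in>Xu m. norm (inv_into (Xu n) (evol B m n) v)
                 \<le> C * b powi (int n - int m) * norm v))))"

definition has_exp_dichotomy ::
    "(nat \<Rightarrow> 'a::real_normed_vector \<Rightarrow>\<^sub>L 'a) \<Rightarrow> real \<Rightarrow> real \<Rightarrow> bool" where
  "has_exp_dichotomy B a b \<longleftrightarrow> (\<exists>Xs Xu. exp_dichotomy B a b Xs Xu)"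

end

theory Submission
  imports Defs
begin

text \<open>Write \<open>Vs\<close> and \<open>Vu\<close> for the stable and unstable cones. Outside the narrow cone \<open>Vs c4\<close> every step expands \<open>Iplus\<close> by the factor \<open>b\<close>, and whenever the
image lies in \<open>Vs c3\<close> the step contracts \<open>Iminus\<close> by the factor \<open>a < b\<close>. Comparing the two rates
shows that \<open>Vu c3\<close> is mapped into itself (\<open>Vu_invariant\<close>) and that \<open>Vs c4\<close> is backward invariant
(\<open>Vs_backward_invariant\<close>). Hence orbits in \<open>Vu c3\<close> grow at least like \<open>b ^ m\<close>, and an orbit that
ends in \<open>Vs c4\<close> at time \<open>m\<close> has been decaying like \<open>a ^ m\<close> all along.

The unstable space \<open>Xu n\<close> is the image at time \<open>n\<close> of an arbitrary \<open>K\<close>-dimensional space inside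
\<open>Vu c3\<close> at time \<open>0\<close>. The stable space is the space of all vectors whose orbit grows at most like
\<open>a ^ m\<close>; with this description linearity and invariance are evident, it meets \<open>Xu n\<close> only in \<open>0\<close>,
and every exponential dichotomy must have this stable space (\<open>exp_dichotomy_stable_eq\<close>).

The point is therefore that the two spaces span. Since \<open>Iplus m\<close> vanishes on the common kernel of
\<open>K\<close> functionals and \<open>Xu n\<close> has dimension \<open>K\<close>, counting dimensions gives for every \<open>v\<close> and
\<open>m \<ge> n\<close> some \<open>w\<close> in \<open>Xu n\<close> such that \<open>Iplus m\<close> vanishes on the image of \<open>v - w\<close> at time \<open>m\<close>
(\<open>Xu_approx\<close>). The orbit of \<open>v - w\<close> then stays in \<open>Vs c4\<close> up to time \<open>m\<close>. The smallness of \<open>c4\<close>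
makes the cones \<open>Vs c4\<close> and \<open>Vu c3\<close> uniformly transversal (\<open>cone_separation\<close>), which bounds \<open>w\<close>,
and the gap between \<open>a\<close> and \<open>b\<close> makes the \<open>w\<close> a Cauchy sequence as \<open>m\<close> tends to infinity. Its
limit splits \<open>v\<close> (\<open>decomposition_exists\<close>). Transversality also bounds the projections uniformly
in \<open>n\<close>, and the two growth estimates are the norm bounds of the dichotomy.\<close>

section \<open>Linear functionals on finite-dimensional subspaces\<close>

text \<open>Each functional lowers the dimension by at most one. Stating this with spanning sets instead of
\<open>dim\<close> covers infinite-dimensional ambient spaces.\<close>

lemma joint_kernel_trivial_imp_span:
  fixes f :: "nat \<Rightarrow> 'a::real_vector \<Rightarrow> real"
  assumes "subspace V" and "\<And>k. linear (f k)"
    and "\<And>z. z \<in> V \<Longrightarrow> \<forall>k\<in>{1..K}. f k z = 0 \<Longrightarrow> z = 0"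
  shows "\<exists>T. finite T \<and> card T \<le> K \<and> V \<subseteq> span T"
  using assms
proof (induction K arbitrary: V)
  case 0
  then have "V \<subseteq> span {}" by auto
  then show ?case by (metis card.empty finite.emptyI order_refl)
next
  case (Suc K)
  show ?case
  proof (cases "\<forall>v\<in>V. f (Suc K) v = 0")
    case True
    have "\<exists>T. finite T \<and> card T \<le> K \<and> V \<subseteq> span T"
    proof (rule Suc.IH)
      fix z assume "z \<in> V" "\<forall>k\<in>{1..K}. f k z = 0"
      with True have "\<forall>k\<in>{1..Suc K}. f k z = 0"
        by (metis atLeastAtMost_iff le_Suc_eq)
      with Suc.prems(3) \<open>z \<in> V\<close> show "z = 0" by blast
    qed (use Suc.prems in auto)
    then show ?thesis using le_SucI by blast
  next
    case False
    then obtain s where s: "s \<in> V" "f (Suc K) s \<noteq> 0" by blast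
    let ?W = "{v \<in> V. f (Suc K) v = 0}"
    \<comment> \<open>the kernel of the last functional in \<open>V\<close> together with \<open>s\<close> spans \<open>V\<close>\<close>
    have "\<exists>T. finite T \<and> card T \<le> K \<and> ?W \<subseteq> span T"
    proof (rule Suc.IH)
      show "subspace ?W"
        using Suc.prems(1) linear_add[OF Suc.prems(2)] linear_cmul[OF Suc.prems(2)]
          linear_0[OF Suc.prems(2)]
        by (auto simp: subspace_def)
      fix z assume "z \<in> ?W" "\<forall>k\<in>{1..K}. f k z = 0"
      then have "\<forall>k\<in>{1..Suc K}. f k z = 0"
        by (metis (mono_tags, lifting) atLeastAtMost_iff le_Suc_eq mem_Collect_eq)
      with Suc.prems(3) \<open>z \<in> ?W\<close> show "z = 0" by blast
    qed (use Suc.prems in auto)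
    then obtain T where T: "finite T" "card T \<le> K" "?W \<subseteq> span T" by blast
    have "v \<in> span (insert s T)" if "v \<in> V" for v
    proof -
      let ?c = "f (Suc K) v / f (Suc K) s"
      have "v - ?c *\<^sub>R s \<in> ?W"
        using that s Suc.prems(1) linear_diff[OF Suc.prems(2)] linear_cmul[OF Suc.prems(2)]
        by (simp add: subspace_diff subspace_scale)
      with T show ?thesis unfolding span_breakdown_eq by blast
    qed
    moreover have "card (insert s T) \<le> Suc K" using T by (simp add: card_insert_if)
    ultimately show ?thesis using T(1) by (metis finite_insert subsetI)
  qed
qed

lemma has_dimension_obtain_basis:
  assumes "has_dimension L K" "subspace L"
  obtains A where "finite A" "independent A" "span A = L" "card A = K"
proof -
  obtain A where A: "A \<subseteq> L" "independent A" "L \<subseteq> span A" "card A = dim L"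
    using basis_exists[of L] by blast
  obtain T where T: "finite T" "span T = L" using assms(1) unfolding has_dimension_def by blast
  have "finite A" using independent_span_bound[OF T(1) A(2)] T(2) A(1) by blast
  moreover have "span A = L" using A(1,3) assms(2) by (rule span_subspace)
  ultimately show thesis using that A assms(1) unfolding has_dimension_def by auto
qed

text \<open>A space of dimension \<open>K\<close> on which \<open>K\<close> functionals have no common zero is a complement of their
common kernel: otherwise adjoining \<open>v\<close> would give a space of dimension \<open>K + 1\<close> with trivial common
kernel.\<close>

lemma interpolate_functionals:
  fixes f :: "nat \<Rightarrow> 'a::real_vector \<Rightarrow> real"
  assumes dim: "has_dimension L K" and sub: "subspace L" and lin: "\<And>k. linear (f k)"
    and ker: "\<And>z. z \<in> L \<Longrightarrow> \<forall>k\<in>{1..K}. f k z = 0 \<Longrightarrow> z = 0"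
  shows "\<exists>w\<in>L. \<forall>k\<in>{1..K}. f k (v - w) = 0"
proof (cases "v \<in> L")
  case True
  then show ?thesis using lin by (auto intro!: bexI[of _ v] simp: linear_0)
next
  case False
  obtain A where A: "finite A" "independent A" "span A = L" "card A = K"
    using dim sub by (rule has_dimension_obtain_basis)
  have ind: "independent (insert v A)"
    using False A by (simp add: independent_insert)
  have "v \<notin> A" using False A span_base by blast
  have "\<exists>z\<in>span (insert v A). (\<forall>k\<in>{1..K}. f k z = 0) \<and> z \<noteq> 0"
  proof (rule ccontr)
    assume "\<not> ?thesis"
    then have "\<And>z. z \<in> span (insert v A) \<Longrightarrow> \<forall>k\<in>{1..K}. f k z = 0 \<Longrightarrow> z = 0" by blast
    from joint_kernel_trivial_imp_span[where f = f, OF subspace_span lin this]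
    obtain T where T: "finite T" "card T \<le> K" "span (insert v A) \<subseteq> span T" by blast
    have "insert v A \<subseteq> span T" using T(3) span_superset[of "insert v A"] by (rule order_trans[rotated])
    then have "card (insert v A) \<le> K" using independent_span_bound[OF T(1) ind] T(2) by simp
    with A \<open>v \<notin> A\<close> show False by simp
  qed
  then obtain z where z: "z \<in> span (insert v A)" "\<forall>k\<in>{1..K}. f k z = 0" "z \<noteq> 0" by blast
  then obtain c where c: "z - c *\<^sub>R v \<in> L" unfolding span_breakdown_eq A(3) by blast
  have "c \<noteq> 0" using c z ker by force
  define w where "w = - ((1 / c) *\<^sub>R (z - c *\<^sub>R v))"
  have "w \<in> L" unfolding w_def using c sub by (intro subspace_neg subspace_scale)
  moreover have "v - w = (1 / c) *\<^sub>R z"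
    using \<open>c \<noteq> 0\<close> by (simp add: w_def algebra_simps)
  ultimately show ?thesis using z lin by (auto simp: linear_cmul intro!: bexI[of _ w])
qed

lemma has_dimension_linear_image:
  assumes dim: "has_dimension L K" and sub: "subspace L" and lin: "linear g" and inj: "inj_on g L"
  shows "has_dimension (g ` L) K"
proof -
  obtain A where A: "finite A" "independent A" "span A = L" "card A = K"
    using dim sub by (rule has_dimension_obtain_basis)
  have "independent (g ` A)"
    using linear_independent_injective_image[OF lin A(2)] inj A(3) by simp
  moreover have "span (g ` A) = g ` L" using linear_span_image[OF lin, of A] A(3) by simp
  moreover have "inj_on g A" using inj_on_subset[OF inj] A(3) span_superset[of A] by simp
  then have "card (g ` A) = K" using A(4) by (simp add: card_image)
  ultimately show ?thesis
    using A(1) dim_span_eq_card_independent[of "g ` A"] unfolding has_dimension_def by auto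
qed

section \<open>Bounded projections\<close>

lemma linear_blinfun_apply: "linear (blinfun_apply f)"
  by (intro linearI blinfun.add_right blinfun.scaleR_right)

lemma direct_sum_decomp_unique:
  assumes "direct_sum_decomp S T" "s \<in> S" "s' \<in> S" "t \<in> T" "t' \<in> T" "s + t = s' + t'"
  shows "s = s'" "t = t'"
proof -
  have "s - s' = t' - t" using assms(6) by (simp add: algebra_simps)
  moreover have "s - s' \<in> S" "t' - t \<in> T"
    using assms unfolding direct_sum_decomp_def by (auto intro: subspace_diff)
  ultimately have "s - s' \<in> S \<inter> T" "t' - t \<in> S \<inter> T" by auto
  then show "s = s'" "t = t'" using assms(1) unfolding direct_sum_decomp_def by auto
qed

text \<open>An a priori bound on the \<open>T\<close>-component makes the algebraic projections bounded; the closed graph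
theorem, and hence closedness of \<open>S\<close> and \<open>T\<close>, is avoided.\<close>

lemma bounded_projections_exist:
  fixes S T :: "'a::real_normed_vector set"
  assumes dec: "direct_sum_decomp S T"
    and bound: "\<And>s t. s \<in> S \<Longrightarrow> t \<in> T \<Longrightarrow> norm t \<le> D * norm (s + t)"
    and D: "D \<ge> 0"
  shows "\<exists>(P :: 'a \<Rightarrow>\<^sub>L 'a) (Q :: 'a \<Rightarrow>\<^sub>L 'a). (\<forall>v. blinfun_apply P v \<in> S \<and> blinfun_apply Q v \<in> T \<and>
             v = blinfun_apply P v + blinfun_apply Q v) \<and>
           norm P + norm Q \<le> 1 + 2 * D"
proof -
  have sub: "subspace S" "subspace T" using dec unfolding direct_sum_decomp_def by auto
  have "\<forall>v. \<exists>t. t \<in> T \<and> v - t \<in> S"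
    using dec unfolding direct_sum_decomp_def by (metis add_diff_cancel_right')
  then obtain q where q: "\<And>v. q v \<in> T" "\<And>v. v - q v \<in> S" by metis
  have uniq: "t = q v" if "t \<in> T" "v - t \<in> S" for t v
    using direct_sum_decomp_unique(2)[OF dec that(2) q(2)[of v] that(1) q(1)[of v]] by simp
  have norm_q: "norm (q v) \<le> D * norm v" for v
    using bound[OF q(2) q(1), of v v] by simp
  have bl: "bounded_linear q"
  proof (rule bounded_linear_intro[where K = D])
    fix x y
    have "x + y - (q x + q y) = (x - q x) + (y - q y)" by (simp add: algebra_simps)
    then have "x + y - (q x + q y) \<in> S" using q(2) sub by (metis subspace_add)
    then show "q (x + y) = q x + q y" using uniq q(1) sub by (metis subspace_add)
  next
    fix r x
    have "r *\<^sub>R x - r *\<^sub>R q x \<in> S"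
      using q(2) sub by (metis scaleR_diff_right subspace_scale)
    then show "q (r *\<^sub>R x) = r *\<^sub>R q x" using uniq q(1) sub by (metis subspace_scale)
  qed (use norm_q in \<open>simp add: mult.commute\<close>)
  define Q where "Q = Blinfun q"
  have Q: "blinfun_apply Q = q" unfolding Q_def using bl by (rule bounded_linear_Blinfun_apply)
  have "norm Q \<le> D" by (rule norm_blinfun_bound) (use D norm_q Q in auto)
  moreover have "norm (id_blinfun - Q) \<le> 1 + D"
    using norm_triangle_ineq4[of "id_blinfun :: 'a \<Rightarrow>\<^sub>L 'a" Q] \<open>norm Q \<le> D\<close>
      norm_blinfun_id_le[where 'a = 'a] by linarith
  ultimately show ?thesis
    by (intro exI[of _ "id_blinfun - Q"] exI[of _ Q]) (auto simp: Q q blinfun.diff_left)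
qed

section \<open>Evolution operators and uniqueness of the stable subspace\<close>

lemma evol_self [simp]: "evol B n n = id_blinfun"
  by (cases n) auto

lemma evol_Suc_apply: "n \<le> m \<Longrightarrow> evol B (Suc m) n v = B m (evol B m n v)"
  by simp

lemma evol_cocycle: "n \<le> p \<Longrightarrow> p \<le> m \<Longrightarrow> evol B m n v = evol B m p (evol B p n v)"
proof (induction m)
  case (Suc m)
  then show ?case by (cases "p = Suc m") (auto simp: le_Suc_eq)
qed simp

text \<open>The intrinsic candidate for the stable subspace: its definition refers neither to cones nor to a
complement.\<close>

definition growth_space :: "(nat \<Rightarrow> 'a::real_normed_vector \<Rightarrow>\<^sub>L 'a) \<Rightarrow> real \<Rightarrow> nat \<Rightarrow> 'a set" where
  "growth_space B a n = {v. \<exists>C. \<forall>m\<ge>n. norm (evol B m n v) \<le> C * a ^ (m - n)}"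

lemma subspace_growth_space: "subspace (growth_space B a n)"
proof (rule subspaceI)
  show "0 \<in> growth_space B a n"
    by (auto simp: growth_space_def intro!: exI[of _ 0])
next
  fix x y assume "x \<in> growth_space B a n" "y \<in> growth_space B a n"
  then obtain C D where "\<forall>m\<ge>n. norm (evol B m n x) \<le> C * a ^ (m - n)"
      "\<forall>m\<ge>n. norm (evol B m n y) \<le> D * a ^ (m - n)"
    unfolding growth_space_def by blast
  then have "\<forall>m\<ge>n. norm (evol B m n (x + y)) \<le> (C + D) * a ^ (m - n)"
    by (simp add: blinfun.add_right distrib_right) (meson add_mono norm_triangle_le)
  then show "x + y \<in> growth_space B a n" unfolding growth_space_def by blast
next
  fix r x assume "x \<in> growth_space B a n"
  then obtain C where "\<forall>m\<ge>n. norm (evol B m n x) \<le> C * a ^ (m - n)"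
    unfolding growth_space_def by blast
  then have "\<forall>m\<ge>n. norm (evol B m n (r *\<^sub>R x)) \<le> (\<bar>r\<bar> * C) * a ^ (m - n)"
    by (simp add: blinfun.scaleR_right mult.assoc mult_left_mono)
  then show "r *\<^sub>R x \<in> growth_space B a n" unfolding growth_space_def by blast
qed

lemma evol_growth_space:
  assumes "v \<in> growth_space B a n" "n \<le> m"
  shows "evol B m n v \<in> growth_space B a m"
proof -
  obtain C where C: "\<And>p. p \<ge> n \<Longrightarrow> norm (evol B p n v) \<le> C * a ^ (p - n)"
    using assms unfolding growth_space_def by blast
  have "norm (evol B p m (evol B m n v)) \<le> (C * a ^ (m - n)) * a ^ (p - m)" if "p \<ge> m" for p
  proof -
    have "norm (evol B p m (evol B m n v)) \<le> C * a ^ (p - n)"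
      using C[of p] evol_cocycle[OF assms(2) that, of B v] that assms(2) by simp
    also have "a ^ (p - n) = a ^ (m - n) * a ^ (p - m)"
      using that assms(2) by (simp flip: power_add)
    finally show ?thesis by (simp add: mult.assoc)
  qed
  then show ?thesis unfolding growth_space_def by blast
qed

text \<open>A lower growth rate \<open>b\<close> and an upper growth rate \<open>a < b\<close> exclude each other, since \<open>(b / a) ^ k\<close>
is unbounded.\<close>

lemma growth_space_fast_growth_eq_0:
  assumes v: "v \<in> growth_space B a n" and ab: "0 < a" "a < b" and d: "d > 0"
    and fast: "\<And>m. n \<le> m \<Longrightarrow> d * b ^ (m - n) * norm v \<le> norm (evol B m n v)"
  shows "v = 0"
proof (rule ccontr)
  assume "v \<noteq> 0"
  obtain C where C: "\<And>m. m \<ge> n \<Longrightarrow> norm (evol B m n v) \<le> C * a ^ (m - n)"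
    using v unfolding growth_space_def by blast
  have "1 < b / a" using ab by simp
  then obtain k where k: "C / (d * norm v) < (b / a) ^ k" using real_arch_pow by blast
  have "C < d * norm v * (b / a) ^ k"
    using k \<open>v \<noteq> 0\<close> d by (simp add: field_simps)
  moreover have "d * b ^ k * norm v \<le> C * a ^ k"
    using fast[of "n + k"] C[of "n + k"] by simp
  then have "d * norm v * (b / a) ^ k \<le> C"
    using ab by (simp add: power_divide field_simps)
  ultimately show False by simp
qed

text \<open>The unstable component of a vector in the growth space again lies in the growth space, but the
dichotomy forces it to grow like \<open>b ^ m\<close>, so it vanishes.\<close>

lemma exp_dichotomy_stable_eq:
  assumes "exp_dichotomy B a b Xs Xu"
  shows "Xs n = growth_space B a n"
proof -
  have ab: "0 < a" "a < b" using assms by (simp_all add: exp_dichotomy_def)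
  obtain Ps Pu :: "nat \<Rightarrow> 'a \<Rightarrow>\<^sub>L 'a" and C
    where P: "\<forall>n v. blinfun_apply (Ps n) v \<in> Xs n \<and> blinfun_apply (Pu n) v \<in> Xu n \<and>
        v = blinfun_apply (Ps n) v + blinfun_apply (Pu n) v"
      and C: "C > 0"
      and bij: "\<forall>n m. n \<le> m \<longrightarrow> bij_betw (evol B m n) (Xu n) (Xu m)"
      and st: "\<forall>n m. n \<le> m \<longrightarrow>
        (\<forall>v\<in>Xs n. norm (evol B m n v) \<le> C * a ^ (m - n) * norm v)"
      and un: "\<forall>n m. n \<le> m \<longrightarrow>
        (\<forall>v\<in>Xu m. norm (inv_into (Xu n) (evol B m n) v)
           \<le> C * b powi (int n - int m) * norm v)"
    using assms unfolding exp_dichotomy_def by (elim conjE exE) (rule that; assumption)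
  have sub: "Xs n \<subseteq> growth_space B a n"
  proof
    fix v assume v: "v \<in> Xs n"
    have "\<forall>m\<ge>n. norm (evol B m n v) \<le> (C * norm v) * a ^ (m - n)"
      using st v by (simp add: mult_ac)
    then show "v \<in> growth_space B a n" unfolding growth_space_def by blast
  qed
  moreover have "v \<in> Xs n" if v: "v \<in> growth_space B a n" for v
  proof -
    have split: "v = Ps n v + Pu n v" using P by blast
    then have "Pu n v = v - Ps n v" by (metis add_diff_cancel_left')
    then have "Pu n v \<in> growth_space B a n"
      using v P sub subspace_growth_space by (metis subspace_diff subsetD)
    then have "Pu n v = 0"
    proof (rule growth_space_fast_growth_eq_0)
      show "1 / C > 0" using C by simp
      fix m assume m: "n \<le> m"
      have mem: "evol B m n (Pu n v) \<in> Xu m" using bij m P unfolding bij_betw_def by blast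
      have "inv_into (Xu n) (evol B m n) (evol B m n (Pu n v)) = Pu n v"
        using bij m P by (meson bij_betw_inv_into_left)
      then have "norm (Pu n v) \<le> C * b powi (int n - int m) * norm (evol B m n (Pu n v))"
        using un m mem by metis
      also have "b powi (int n - int m) = 1 / b ^ (m - n)"
        using m ab by (auto simp: power_int_def inverse_eq_divide nat_diff_distrib' power_one_over
            simp flip: of_nat_diff)
      finally show "1 / C * b ^ (m - n) * norm (Pu n v) \<le> norm (evol B m n (Pu n v))"
        using C ab by (simp add: field_simps)
    qed (use ab in auto)
    then show ?thesis using split P by (metis add.right_neutral)
  qed
  ultimately show ?thesis by blast
qed

section \<open>Cones and growth rates\<close>

lemma max_functional_ge:
  "k \<in> {1..K} \<Longrightarrow> \<bar>blinfun_apply (\<alpha> k n) v\<bar> \<le> max_functional K \<alpha> n v"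
  by (auto simp: max_functional_def intro!: Max_ge)

lemma max_functional_le:
  assumes "\<And>k. k \<in> {1..K} \<Longrightarrow> \<bar>blinfun_apply (\<alpha> k n) v\<bar> \<le> C" "C \<ge> 0"
  shows "max_functional K \<alpha> n v \<le> C"
  using assms by (auto simp: max_functional_def)

lemma max_functional_nonneg: "max_functional K \<alpha> n v \<ge> 0"
proof (cases "K = 0")
  case False
  then show ?thesis using max_functional_ge[of 1 K \<alpha> n v] abs_ge_zero order_trans by auto
qed (simp add: max_functional_def)

lemma max_functional_diff_le:
  "max_functional K \<alpha> n (v - w) \<le> max_functional K \<alpha> n v + max_functional K \<alpha> n w"
proof (rule max_functional_le)
  fix k assume "k \<in> {1..K}"
  then show "\<bar>blinfun_apply (\<alpha> k n) (v - w)\<bar> \<le> max_functional K \<alpha> n v + max_functional K \<alpha> n w"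
    using max_functional_ge[of k K \<alpha> n v] max_functional_ge[of k K \<alpha> n w]
    by (simp add: blinfun.diff_right)
qed (simp add: max_functional_nonneg)

locale cone_system =
  fixes B :: "nat \<Rightarrow> 'a::banach \<Rightarrow>\<^sub>L 'a"
    and Iminus Iplus :: "nat \<Rightarrow> 'a \<Rightarrow> real"
    and \<alpha> :: "nat \<Rightarrow> nat \<Rightarrow> 'a \<Rightarrow>\<^sub>L real"
    and K :: nat
    and c1 c2 c3 c4 a b :: real
  assumes Iminus_nonneg: "\<And>n v. Iminus n v \<ge> 0"
    and Iplus_nonneg: "\<And>n v. Iplus n v \<ge> 0"
    and Iminus_cont: "\<And>n. continuous_on UNIV (Iminus n)"
    and Iplus_cont: "\<And>n. continuous_on UNIV (Iplus n)"
    and c_pos: "c1 > 0" "c2 > 0" "c3 > 0" "c4 > 0"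
    and ab: "0 < a" "a < b"
    and norm_equiv: "\<And>n v. c1 * norm v \<le> Iminus n v + Iplus n v \<and>
                         Iminus n v + Iplus n v \<le> 1 / c1 * norm v"
    and Iplus_equiv: "\<And>n v. c2 * max_functional K \<alpha> n v \<le> Iplus n v \<and>
                         Iplus n v \<le> 1 / c2 * max_functional K \<alpha> n v"
    and cone_dim: "\<And>n. \<exists>L. subspace L \<and> has_dimension L K \<and> L \<subseteq> unstable_cone Iminus Iplus c3 n"
    and c4_small: "c4 < 1 / 3 * (c1 * c2)\<^sup>2 * (c3 / (1 + c3))"
    and contraction: "\<And>n v. B n v \<in> stable_cone Iminus Iplus c3 (Suc n) \<Longrightarrow>
                         Iminus (Suc n) (B n v) \<le> a * Iminus n v"
    and expansion: "\<And>n v. v \<in> unstable_cone Iminus Iplus c4 n \<Longrightarrow>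
                         Iplus (Suc n) (B n v) \<ge> b * Iplus n v"
begin

abbreviation "Vs \<equiv> stable_cone Iminus Iplus"
abbreviation "Vu \<equiv> unstable_cone Iminus Iplus"

lemma b_pos: "b > 0" using ab by simp

lemma norm_le_functionals: "norm v \<le> (Iminus n v + Iplus n v) / c1"
  using norm_equiv[of v n] c_pos by (simp add: field_simps)

lemma Iminus_le_norm: "Iminus n v \<le> norm v / c1"
  using norm_equiv[of v n] Iplus_nonneg[of n v] by simp

lemma Iplus_le_norm: "Iplus n v \<le> norm v / c1"
  using norm_equiv[of v n] Iminus_nonneg[of n v] by simp

text \<open>Although \<open>Iplus n\<close> need not be a seminorm, its zero set is a linear space given by \<open>K\<close> equations,
so that dimensions can be counted.\<close>

lemma Iplus_eq_0_iff: "Iplus n v = 0 \<longleftrightarrow> (\<forall>k\<in>{1..K}. \<alpha> k n v = 0)"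
proof
  assume "Iplus n v = 0"
  then have "max_functional K \<alpha> n v \<le> 0"
    using Iplus_equiv[of n v] c_pos by (simp add: mult_le_0_iff)
  then show "\<forall>k\<in>{1..K}. \<alpha> k n v = 0"
    using max_functional_ge[of _ K \<alpha> n v] by fastforce
next
  assume "\<forall>k\<in>{1..K}. \<alpha> k n v = 0"
  then have "max_functional K \<alpha> n v \<le> 0" by (intro max_functional_le) auto
  then have "1 / c2 * max_functional K \<alpha> n v \<le> 0"
    using c_pos by (simp add: divide_le_0_iff)
  then show "Iplus n v = 0" using Iplus_equiv[of n v] Iplus_nonneg[of n v] by linarith
qed

lemma c4_bound: "3 * c4 < (c1 * c2)\<^sup>2 * (c3 / (1 + c3))"
proof -
  define q where "q = (c1 * c2)\<^sup>2 * (c3 / (1 + c3))"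
  have "c4 < 1 / 3 * q" using c4_small unfolding q_def by (simp only: mult.assoc)
  then show ?thesis unfolding q_def[symmetric] by simp
qed

text \<open>Without a vector with \<open>Iplus n v > 0\<close> the constant \<open>c2\<close> is unconstrained (for \<open>K = 0\<close>, say), and
\<open>c4\<close> may exceed \<open>c3\<close>. Such a vector forces \<open>c1 \<le> 1\<close> and \<open>c2 \<le> 1\<close>.\<close>

lemma c4_less_c3:
  assumes "Iplus n v > 0"
  shows "c4 < c3"
proof -
  \<comment> \<open>a two-sided bound by \<open>x\<close> and \<open>1 / x\<close> forces \<open>x \<le> 1\<close> as soon as the quantity is positive\<close>
  have le1: "x \<le> 1" if "x * y \<le> 1 / x * y" "x > 0" "y > 0" for x y :: real
  proof -
    have "x * x \<le> 1" using that by (simp add: field_simps)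
    then show ?thesis using that(2) power2_le_imp_le[of x 1] by (simp add: power2_eq_square)
  qed
  have "norm v / c1 > 0" using Iplus_le_norm[of n v] assms by linarith
  then have "norm v > 0" using c_pos by (simp add: zero_less_divide_iff)
  then have "c1 \<le> 1" using le1 norm_equiv[of v n] c_pos by (meson order_trans)
  have "1 / c2 * max_functional K \<alpha> n v > 0" using Iplus_equiv[of n v] assms by linarith
  then have "max_functional K \<alpha> n v > 0" using c_pos by (simp add: zero_less_divide_iff)
  then have "c2 \<le> 1" using le1 Iplus_equiv[of n v] c_pos by (meson order_trans)
  have "c1 * c2 \<le> 1" using \<open>c1 \<le> 1\<close> \<open>c2 \<le> 1\<close> c_pos by (simp add: mult_le_one)
  then have "(c1 * c2)\<^sup>2 \<le> 1" using c_pos by (simp add: power_le_one)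
  moreover have "c3 / (1 + c3) \<le> c3" "c3 / (1 + c3) \<ge> 0" using c_pos by (simp_all add: field_simps)
  ultimately have "(c1 * c2)\<^sup>2 * (c3 / (1 + c3)) \<le> 1 * c3"
    by (intro mult_mono) auto
  then show ?thesis using c4_bound c_pos(4) by linarith
qed

lemma Vs_c4_subset: "Vs c4 n \<subseteq> Vs c3 n"
proof
  fix v assume "v \<in> Vs c4 n"
  then have v: "Iplus n v \<le> c4 * Iminus n v" by (simp add: stable_cone_def)
  show "v \<in> Vs c3 n"
  proof (cases "Iplus n v > 0")
    case True
    then have "c4 * Iminus n v \<le> c3 * Iminus n v"
      using c4_less_c3[of n v] Iminus_nonneg[of n v] by (simp add: mult_right_mono)
    then show ?thesis using v by (simp add: stable_cone_def)
  next
    case False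
    then show ?thesis using c_pos Iminus_nonneg[of n v] Iplus_nonneg[of n v]
      by (simp add: stable_cone_def)
  qed
qed

lemma Vu_c3_subset: "Vu c3 n \<subseteq> Vu c4 n"
proof
  fix v assume "v \<in> Vu c3 n"
  then have v: "c3 * Iminus n v \<le> Iplus n v" by (simp add: unstable_cone_def)
  show "v \<in> Vu c4 n"
  proof (cases "Iplus n v > 0")
    case True
    then have "c4 * Iminus n v \<le> c3 * Iminus n v"
      using c4_less_c3[of n v] Iminus_nonneg[of n v] by (simp add: mult_right_mono)
    then show ?thesis using v by (simp add: unstable_cone_def)
  next
    case False
    then have "c3 * Iminus n v \<le> 0" using v by simp
    then have "Iminus n v = 0" using c_pos Iminus_nonneg[of n v] by (simp add: mult_le_0_iff)
    then show ?thesis using Iplus_nonneg[of n v] by (simp add: unstable_cone_def)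
  qed
qed

text \<open>If the image left \<open>Vu c3\<close>, the contraction of \<open>Iminus\<close> would apply, and together with the expansion
of \<open>Iplus\<close> it increases the ratio of \<open>Iplus\<close> to \<open>Iminus\<close>, a contradiction.\<close>

lemma Vu_invariant:
  assumes v: "v \<in> Vu c3 n"
  shows "B n v \<in> Vu c3 (Suc n)"
proof (rule ccontr)
  assume "\<not> ?thesis"
  then have less: "Iplus (Suc n) (B n v) < c3 * Iminus (Suc n) (B n v)"
    by (simp add: unstable_cone_def)
  then have "Iminus (Suc n) (B n v) \<le> a * Iminus n v"
    by (intro contraction) (simp add: stable_cone_def)
  then have "c3 * Iminus (Suc n) (B n v) \<le> c3 * (a * Iminus n v)"
    using c_pos by (intro mult_left_mono) auto
  also have "\<dots> = a * (c3 * Iminus n v)" by simp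
  also have "\<dots> \<le> a * Iplus n v"
    using v ab by (intro mult_left_mono) (auto simp: unstable_cone_def)
  also have "\<dots> \<le> b * Iplus n v"
    using ab Iplus_nonneg by (intro mult_right_mono) auto
  also have "\<dots> \<le> Iplus (Suc n) (B n v)"
    using expansion v Vu_c3_subset by blast
  finally show False using less by simp
qed

text \<open>A vector outside \<open>Vs c4\<close> is expanded, while an image in \<open>Vs c4\<close>, and so in \<open>Vs c3\<close>, is contracted;
both together push the image further away from \<open>Vs c4\<close>.\<close>

lemma Vs_backward_invariant:
  assumes v: "B n v \<in> Vs c4 (Suc n)"
  shows "v \<in> Vs c4 n"
proof (rule ccontr)
  assume "\<not> ?thesis"
  then have less: "c4 * Iminus n v < Iplus n v" by (simp add: stable_cone_def)
  have "b * Iplus n v \<le> Iplus (Suc n) (B n v)"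
    using less by (intro expansion) (simp add: unstable_cone_def)
  also have "\<dots> \<le> c4 * Iminus (Suc n) (B n v)" using v by (simp add: stable_cone_def)
  also have "\<dots> \<le> c4 * (a * Iminus n v)"
    using c_pos contraction v Vs_c4_subset by (intro mult_left_mono) auto
  also have "\<dots> = a * (c4 * Iminus n v)" by simp
  also have "\<dots> < a * Iplus n v" using less ab by simp
  also have "\<dots> \<le> b * Iplus n v" using ab Iplus_nonneg by (intro mult_right_mono) auto
  finally show False by simp
qed

lemma Vs_backward_evol:
  assumes "n \<le> m" "evol B m n v \<in> Vs c4 m"
  shows "v \<in> Vs c4 n \<and> Iminus m (evol B m n v) \<le> a ^ (m - n) * Iminus n v"
  using assms
proof (induction m rule: dec_induct)
  case (step m)
  then have *: "B m (evol B m n v) \<in> Vs c4 (Suc m)" by (simp add: evol_Suc_apply)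
  then have "evol B m n v \<in> Vs c4 m" by (rule Vs_backward_invariant)
  with step have IH: "v \<in> Vs c4 n" "Iminus m (evol B m n v) \<le> a ^ (m - n) * Iminus n v" by auto
  have "Iminus (Suc m) (B m (evol B m n v)) \<le> a * Iminus m (evol B m n v)"
    using contraction * Vs_c4_subset by blast
  also have "\<dots> \<le> a * (a ^ (m - n) * Iminus n v)" using IH ab by simp
  finally show ?case using IH step by (simp add: evol_Suc_apply Suc_diff_le mult.assoc)
qed simp

lemma Vs_evol_intermediate:
  assumes "n \<le> p" "p \<le> m" "evol B m n v \<in> Vs c4 m"
  shows "evol B p n v \<in> Vs c4 p"
  using Vs_backward_evol[of p m "evol B p n v"] assms evol_cocycle by metis

lemma Vs_evol_norm:
  assumes "n \<le> m" "evol B m n v \<in> Vs c4 m"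
  shows "norm (evol B m n v) \<le> (1 + c4) / c1\<^sup>2 * a ^ (m - n) * norm v"
proof -
  let ?w = "evol B m n v"
  have "norm ?w \<le> (Iminus m ?w + Iplus m ?w) / c1" by (rule norm_le_functionals)
  also have "\<dots> \<le> ((1 + c4) * Iminus m ?w) / c1"
    using assms c_pos by (intro divide_right_mono) (auto simp: stable_cone_def algebra_simps)
  also have "\<dots> \<le> ((1 + c4) * (a ^ (m - n) * (norm v / c1))) / c1"
  proof -
    have "Iminus m ?w \<le> a ^ (m - n) * Iminus n v" using Vs_backward_evol assms by blast
    also have "\<dots> \<le> a ^ (m - n) * (norm v / c1)"
      using Iminus_le_norm ab by (intro mult_left_mono) auto
    finally show ?thesis using c_pos by (intro divide_right_mono mult_left_mono) auto
  qed
  finally show ?thesis by (simp add: power2_eq_square field_simps)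
qed

lemma Vu_Iplus_ge:
  assumes "v \<in> Vu c3 n"
  shows "c1 * c3 / (1 + c3) * norm v \<le> Iplus n v"
proof -
  have "c3 * (c1 * norm v) \<le> c3 * (Iminus n v + Iplus n v)"
    using norm_equiv[of v n] c_pos by (intro mult_left_mono) auto
  also have "\<dots> \<le> (1 + c3) * Iplus n v" using assms by (simp add: unstable_cone_def algebra_simps)
  finally show ?thesis using c_pos by (simp add: field_simps)
qed

lemma Vu_evol:
  assumes "n \<le> m" "v \<in> Vu c3 n"
  shows "evol B m n v \<in> Vu c3 m \<and> b ^ (m - n) * Iplus n v \<le> Iplus m (evol B m n v)"
  using assms
proof (induction m rule: dec_induct)
  case (step m)
  then have IH: "evol B m n v \<in> Vu c3 m" "b ^ (m - n) * Iplus n v \<le> Iplus m (evol B m n v)" by auto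
  have "b * (b ^ (m - n) * Iplus n v) \<le> b * Iplus m (evol B m n v)" using IH b_pos by simp
  also have "\<dots> \<le> Iplus (Suc m) (B m (evol B m n v))"
    using expansion IH Vu_c3_subset by blast
  finally show ?case using IH step Vu_invariant by (simp add: evol_Suc_apply Suc_diff_le mult.assoc)
qed simp

lemma Vu_evol_norm:
  assumes "n \<le> m" "v \<in> Vu c3 n"
  shows "c1\<^sup>2 * c3 / (1 + c3) * b ^ (m - n) * norm v \<le> norm (evol B m n v)"
proof -
  have "b ^ (m - n) * (c1 * c3 / (1 + c3) * norm v) \<le> b ^ (m - n) * Iplus n v"
    using Vu_Iplus_ge assms b_pos by (intro mult_left_mono) auto
  also have "\<dots> \<le> norm (evol B m n v) / c1"
    using Vu_evol[OF assms] Iplus_le_norm order_trans by blast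
  finally show ?thesis using c_pos by (simp add: field_simps power2_eq_square)
qed

text \<open>On \<open>Vu c3\<close> the functionals control the norm from below, on \<open>Vs c4\<close> they are of size \<open>c4\<close>.
As \<open>max_functional\<close> is subadditive, unlike \<open>Iplus\<close>, they yield
\<open>3 * c4 * norm t \<le> norm (s + t) + c4 * norm s\<close>, and \<open>norm s\<close> is at most
\<open>norm (s + t) + norm t\<close>.\<close>

lemma cone_separation:
  assumes s: "s \<in> Vs c4 n" and t: "t \<in> Vu c3 n"
  shows "norm t \<le> (1 + c4) / (2 * c4) * norm (s + t)"
proof -
  let ?M = "max_functional K \<alpha> n"
  have M: "?M v \<le> Iplus n v / c2" for v
    using Iplus_equiv[of n v] c_pos by (simp add: field_simps)
  have "Iplus n s \<le> c4 * (norm s / c1)"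
    using s c_pos mult_left_mono[OF Iminus_le_norm[of n s], of c4] by (simp add: stable_cone_def)
  also have "\<dots> \<le> c4 * ((norm (s + t) + norm t) / c1)"
    using c_pos norm_triangle_ineq4[of "s + t" t] by (intro mult_left_mono divide_right_mono) auto
  finally have Is: "Iplus n s \<le> c4 * ((norm (s + t) + norm t) / c1)" .
  have "c1 * c3 / (1 + c3) * norm t \<le> Iplus n t" using t by (rule Vu_Iplus_ge)
  also have "\<dots> \<le> ?M t / c2" using Iplus_equiv[of n t] by simp
  also have "\<dots> \<le> (?M (s + t) + ?M s) / c2"
    using max_functional_diff_le[of K \<alpha> n "s + t" s] c_pos by (intro divide_right_mono) auto
  also have "\<dots> \<le> (Iplus n (s + t) / c2 + Iplus n s / c2) / c2"
    using M[of s] M[of "s + t"] c_pos by (intro divide_right_mono add_mono) auto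
  also have "\<dots> \<le> (norm (s + t) / c1 / c2 + c4 * ((norm (s + t) + norm t) / c1) / c2) / c2"
    using Is Iplus_le_norm[of n "s + t"] c_pos by (intro divide_right_mono add_mono) auto
  finally have "(c1 * c2)\<^sup>2 * (c3 / (1 + c3)) * norm t
      \<le> norm (s + t) + c4 * (norm (s + t) + norm t)"
    using c_pos by (simp add: field_simps power2_eq_square)
  moreover have "3 * c4 * norm t \<le> (c1 * c2)\<^sup>2 * (c3 / (1 + c3)) * norm t"
    using c4_bound by (intro mult_right_mono) auto
  ultimately have "2 * c4 * norm t \<le> (1 + c4) * norm (s + t)" by (simp add: algebra_simps)
  then show ?thesis using c_pos by (simp add: field_simps)
qed

section \<open>The unstable spaces\<close>

definition L0 :: "'a set" where
  "L0 = (SOME L. subspace L \<and> has_dimension L K \<and> L \<subseteq> Vu c3 0)"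

definition Xu :: "nat \<Rightarrow> 'a set" where
  "Xu n = evol B n 0 ` L0"

lemma L0: "subspace L0" "has_dimension L0 K" "L0 \<subseteq> Vu c3 0"
  using someI_ex[OF cone_dim[of 0]] unfolding L0_def by auto

lemma Xu_subspace: "subspace (Xu n)"
  unfolding Xu_def using L0(1) by (intro linear_subspace_image) (rule linear_blinfun_apply)

lemma Xu_cone: "Xu n \<subseteq> Vu c3 n"
  using L0(3) Vu_evol[of 0 n] unfolding Xu_def by blast

lemma Xu_diff_cone: "x \<in> Xu n \<Longrightarrow> y \<in> Xu n \<Longrightarrow> x - y \<in> Vu c3 n"
  using subspace_diff[OF Xu_subspace] Xu_cone by blast

lemma evol_image_Xu: "n \<le> m \<Longrightarrow> evol B m n ` Xu n = Xu m"
  unfolding Xu_def by (auto simp: image_image evol_cocycle[of 0 n m])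

lemma evol_eq_0_imp:
  assumes "n \<le> m" "v \<in> Vu c3 n" "evol B m n v = 0"
  shows "v = 0"
proof -
  have "c1\<^sup>2 * c3 / (1 + c3) * b ^ (m - n) * norm v \<le> 0" using Vu_evol_norm[OF assms(1,2)] assms(3) by simp
  moreover have "c1\<^sup>2 * c3 / (1 + c3) * b ^ (m - n) > 0" using c_pos b_pos by simp
  ultimately have "norm v \<le> 0" using mult_pos_pos not_le by blast
  then show ?thesis by simp
qed

lemma inj_on_evol:
  assumes "subspace L" "L \<subseteq> Vu c3 n" "n \<le> m"
  shows "inj_on (evol B m n) L"
proof (rule inj_onI)
  fix x y assume "x \<in> L" "y \<in> L" "evol B m n x = evol B m n y"
  then have "x - y \<in> L" "evol B m n (x - y) = 0"
    using assms(1) by (auto simp: subspace_diff blinfun.diff_right)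
  then show "x = y" using evol_eq_0_imp assms by fastforce
qed

lemma Xu_dim: "has_dimension (Xu n) K"
  unfolding Xu_def using L0 inj_on_evol[of L0 0 n]
  by (intro has_dimension_linear_image) (auto intro: linear_blinfun_apply)

text \<open>This is \<open>interpolate_functionals\<close> for the functionals pulled back from time \<open>m\<close> to time \<open>n\<close>; they have no common zero on
\<open>Xu n\<close> because orbits starting there stay in \<open>Vu c3\<close> and grow.\<close>

lemma Xu_approx:
  assumes "n \<le> m"
  shows "\<exists>w\<in>Xu n. Iplus m (evol B m n (v - w)) = 0"
proof -
  have "\<exists>w\<in>Xu n. \<forall>k\<in>{1..K}. \<alpha> k m (evol B m n (v - w)) = 0"
  proof (rule interpolate_functionals[OF Xu_dim Xu_subspace])
    show "linear (\<lambda>x. \<alpha> k m (evol B m n x))" for k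
      by (intro linearI) (auto simp: blinfun.add_right blinfun.scaleR_right)
    fix z assume z: "z \<in> Xu n" and "\<forall>k\<in>{1..K}. \<alpha> k m (evol B m n z) = 0"
    then have "Iplus m (evol B m n z) = 0" by (simp add: Iplus_eq_0_iff)
    moreover have "evol B m n z \<in> Vu c3 m" using Vu_evol[OF assms] z Xu_cone by blast
    ultimately have "c1 * c3 / (1 + c3) * norm (evol B m n z) \<le> 0"
      using Vu_Iplus_ge by fastforce
    then have "evol B m n z = 0" using c_pos by (simp add: mult_le_0_iff divide_le_0_iff)
    then show "z = 0" using evol_eq_0_imp assms z Xu_cone by blast
  qed
  then show ?thesis by (simp add: Iplus_eq_0_iff)
qed

lemma Iplus_0_in_Vs: "Iplus n v = 0 \<Longrightarrow> v \<in> Vs c4 n"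
  using c_pos Iminus_nonneg[of n v] by (simp add: stable_cone_def)

text \<open>The limit \<open>l\<close> of a sequence in \<open>Xu n\<close> differs from some \<open>w\<close> in \<open>Xu n\<close> by a zero of \<open>Iplus n\<close>,
and \<open>cone_separation\<close> shows that the sequence tends to \<open>w\<close> as well.\<close>

lemma Xu_closed: "closed (Xu n)"
  unfolding closed_sequential_limits
proof (intro allI impI, elim conjE)
  fix x l assume x: "\<forall>j. x j \<in> Xu n" and lim: "x \<longlonglongrightarrow> l"
  obtain w where w: "w \<in> Xu n" "Iplus n (evol B n n (l - w)) = 0"
    using Xu_approx[of n n l] by blast
  have Z: "Iplus n (w - l) = 0"
    using w(2) by (simp add: Iplus_eq_0_iff blinfun.diff_right)
  have "norm (x j - w) \<le> (1 + c4) / (2 * c4) * norm (x j - l)" for j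
  proof -
    have "x j - w \<in> Vu c3 n" using x w(1) Xu_diff_cone by blast
    then show ?thesis using cone_separation[OF Iplus_0_in_Vs[OF Z], of "x j - w"] by simp
  qed
  moreover have "(\<lambda>j. (1 + c4) / (2 * c4) * norm (x j - l)) \<longlonglongrightarrow> 0"
    using lim by (intro tendsto_mult_right_zero tendsto_norm_zero) (simp add: LIM_zero)
  ultimately have "(\<lambda>j. x j - w) \<longlonglongrightarrow> 0"
    by (intro Lim_null_comparison[of "\<lambda>j. x j - w"]) auto
  then have "x \<longlonglongrightarrow> w" by (simp add: LIM_zero_iff)
  then have "l = w" using lim by (rule LIMSEQ_unique[rotated])
  then show "l \<in> Xu n" using w(1) by simp
qed

section \<open>The dichotomy\<close>

lemma closed_Vs: "closed (Vs c n)"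
  unfolding stable_cone_def
  by (intro closed_Collect_le continuous_on_mult continuous_on_const Iplus_cont Iminus_cont)

lemma cone_orbit_in_growth_space:
  assumes "\<And>m. n \<le> m \<Longrightarrow> evol B m n v \<in> Vs c4 m"
  shows "v \<in> growth_space B a n"
proof -
  have "norm (evol B m n v) \<le> ((1 + c4) / c1\<^sup>2 * norm v) * a ^ (m - n)" if "n \<le> m" for m
    using Vs_evol_norm[OF that assms[OF that]] by (simp add: mult_ac)
  then show ?thesis unfolding growth_space_def by blast
qed

lemma growth_space_Int_Xu:
  assumes "v \<in> growth_space B a n" "v \<in> Xu n"
  shows "v = 0"
proof (rule growth_space_fast_growth_eq_0[OF assms(1) ab])
  show "c1\<^sup>2 * c3 / (1 + c3) > 0" using c_pos by simp
  show "c1\<^sup>2 * c3 / (1 + c3) * b ^ (m - n) * norm v \<le> norm (evol B m n v)" if "n \<le> m" for m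
    using that assms(2) Xu_cone by (intro Vu_evol_norm) auto
qed

text \<open>The approximations \<open>w j\<close> are those of \<open>Xu_approx\<close> at time \<open>n + j\<close>. For \<open>i \<le> j\<close> the difference
\<open>w i - w j\<close> lies in \<open>Xu n\<close>, so its norm at time \<open>n + i\<close> is at least a multiple of \<open>b ^ i\<close> times
its norm; as a difference of two vectors whose orbits are in the stable cones up to that time, it is
also at most a multiple of \<open>a ^ i\<close>.\<close>

lemma decomposition_exists:
  "\<exists>w\<in>Xu n. \<forall>m\<ge>n. evol B m n (v - w) \<in> Vs c4 m"
proof -
  have "\<forall>j. \<exists>w. w \<in> Xu n \<and> Iplus (n + j) (evol B (n + j) n (v - w)) = 0"
    using Xu_approx le_add1 by blast
  then obtain w where w: "\<And>j. w j \<in> Xu n"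
      "\<And>j. Iplus (n + j) (evol B (n + j) n (v - w j)) = 0" by metis
  have cone: "evol B (n + i) n (v - w j) \<in> Vs c4 (n + i)" if "i \<le> j" for i j
    using Vs_evol_intermediate[of n "n + i" "n + j"] that Iplus_0_in_Vs[OF w(2)] by simp
  define D where "D = (1 + c4) / (2 * c4)"
  have bound: "norm (v - w j) \<le> (1 + D) * norm v" for j
  proof -
    have "norm (w j) \<le> D * norm v"
      using cone_separation[of "v - w j" n "w j"] cone[of 0 j] w(1) Xu_cone by (auto simp: D_def)
    then show ?thesis using norm_triangle_ineq4[of v "w j"] by (simp add: algebra_simps)
  qed
  define d where "d = c1\<^sup>2 * c3 / (1 + c3)"
  have "d > 0" using c_pos by (simp add: d_def)
  define E where "E = (1 + c4) / c1\<^sup>2 * ((1 + D) * norm v)"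
  have small: "norm (evol B (n + i) n (v - w j)) \<le> E * a ^ i" if "i \<le> j" for i j
  proof -
    have "norm (evol B (n + i) n (v - w j)) \<le> (1 + c4) / c1\<^sup>2 * a ^ i * norm (v - w j)"
      using Vs_evol_norm[OF _ cone[OF that]] by simp
    also have "\<dots> \<le> (1 + c4) / c1\<^sup>2 * a ^ i * ((1 + D) * norm v)"
      using bound c_pos ab by (intro mult_left_mono) auto
    finally show ?thesis by (simp add: E_def mult_ac)
  qed
  have dist: "norm (w i - w j) \<le> 2 * E / d * (a / b) ^ i" if "i \<le> j" for i j
  proof -
    have "w i - w j \<in> Vu c3 n" using w(1) Xu_diff_cone by blast
    then have "d * b ^ i * norm (w i - w j) \<le> norm (evol B (n + i) n (w i - w j))"
      using Vu_evol_norm[of n "n + i"] by (simp add: d_def)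
    also have "evol B (n + i) n (w i - w j) =
        evol B (n + i) n (v - w j) - evol B (n + i) n (v - w i)"
      by (simp add: blinfun.diff_right)
    also have "norm \<dots> \<le> E * a ^ i + E * a ^ i"
      using small[OF that] small[of i i] by (intro norm_triangle_le_diff add_mono) auto
    finally show ?thesis using \<open>d > 0\<close> b_pos by (simp add: field_simps power_divide)
  qed
  have null: "(\<lambda>i. 2 * E / d * (a / b) ^ i) \<longlonglongrightarrow> 0"
    using ab by (intro tendsto_mult_right_zero LIMSEQ_realpow_zero) auto
  have "Cauchy w"
  proof (rule metric_CauchyI)
    fix e :: real assume "e > 0"
    then obtain N where N: "\<And>i. i \<ge> N \<Longrightarrow> 2 * E / d * (a / b) ^ i < e / 2"
      using order_tendstoD(2)[OF null, of "e / 2"] unfolding eventually_sequentially by auto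
    have "dist (w i) (w j) < e" if "i \<ge> N" "j \<ge> N" for i j
    proof -
      have "norm (w N - w i) < e / 2" "norm (w N - w j) < e / 2"
        using dist[OF that(1)] dist[OF that(2)] N[of N] by simp_all
      then show ?thesis
        by (metis dist_norm dist_triangle_half_r)
    qed
    then show "\<exists>N. \<forall>i\<ge>N. \<forall>j\<ge>N. dist (w i) (w j) < e" by blast
  qed
  then obtain l where l: "w \<longlonglongrightarrow> l" using Cauchy_convergent[of w] unfolding convergent_def by blast
  have "l \<in> Xu n" by (rule closed_sequentially[OF Xu_closed w(1) l])
  moreover have "evol B m n (v - l) \<in> Vs c4 m" if "n \<le> m" for m
  proof -
    define i where "i = m - n"
    then have i: "m = n + i" using that by simp
    \<comment> \<open>from index \<open>i\<close> on, the approximating orbits are in the closed stable cone at time \<open>n + i\<close>\<close>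
    have "(\<lambda>j. evol B m n (v - w (j + i))) \<longlonglongrightarrow> evol B m n (v - l)"
      using LIMSEQ_ignore_initial_segment[OF l] by (intro tendsto_intros)
    then show ?thesis
      by (rule closed_sequentially[OF closed_Vs, rotated]) (simp add: i cone)
  qed
  ultimately show ?thesis by blast
qed

lemma direct_sum: "direct_sum_decomp (growth_space B a n) (Xu n)"
proof -
  have "\<exists>s\<in>growth_space B a n. \<exists>t\<in>Xu n. v = s + t" for v
    using decomposition_exists[of n v] cone_orbit_in_growth_space
    by (metis diff_add_cancel)
  then show ?thesis
    using growth_space_Int_Xu subspace_growth_space[of B a n] Xu_subspace[of n]
    unfolding direct_sum_decomp_def by (auto intro: subspace_0)
qed

lemma growth_space_cone_orbit:
  assumes v: "v \<in> growth_space B a n" and "n \<le> m"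
  shows "evol B m n v \<in> Vs c4 m"
proof -
  obtain w where w: "w \<in> Xu n" "\<forall>m\<ge>n. evol B m n (v - w) \<in> Vs c4 m"
    using decomposition_exists by blast
  then have "v - w \<in> growth_space B a n" using cone_orbit_in_growth_space by blast
  then have "v - (v - w) \<in> growth_space B a n" using v subspace_growth_space subspace_diff by blast
  then have "w = 0" using growth_space_Int_Xu w by simp
  then show ?thesis using w \<open>n \<le> m\<close> by simp
qed

lemma growth_space_subset_Vs: "growth_space B a n \<subseteq> Vs c4 n"
  using growth_space_cone_orbit[of _ n n] by auto

lemma dichotomy: "exp_dichotomy B a b (growth_space B a) Xu"
proof -
  let ?Xs = "growth_space B a"
  define D where "D = (1 + c4) / (2 * c4)"
  have "D \<ge> 0" using c_pos by (simp add: D_def)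
  \<comment> \<open>an opaque predicate for the choice of both projections, uniformly bounded in \<open>n\<close>\<close>
  define R where "R n P Q \<longleftrightarrow>
      (\<forall>v. blinfun_apply P v \<in> ?Xs n \<and> blinfun_apply Q v \<in> Xu n \<and>
           v = blinfun_apply P v + blinfun_apply Q v) \<and>
      norm P + norm Q \<le> 1 + 2 * D" for n P Q
  have "\<exists>P Q. R n P Q" for n
    unfolding R_def
  proof (rule bounded_projections_exist[OF direct_sum _ \<open>D \<ge> 0\<close>])
    fix s t assume "s \<in> ?Xs n" "t \<in> Xu n"
    then show "norm t \<le> D * norm (s + t)"
      unfolding D_def using growth_space_subset_Vs Xu_cone by (intro cone_separation) auto
  qed
  then obtain Ps Pu where "\<And>n. R n (Ps n) (Pu n)" by metis
  then have P: "blinfun_apply (Ps n) v \<in> ?Xs n" "blinfun_apply (Pu n) v \<in> Xu n"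
    "v = blinfun_apply (Ps n) v + blinfun_apply (Pu n) v"
    "norm (Ps n) + norm (Pu n) \<le> 1 + 2 * D" for n v
    unfolding R_def by blast+
  define d where "d = c1\<^sup>2 * c3 / (1 + c3)"
  have "d > 0" using c_pos by (simp add: d_def)
  \<comment> \<open>one constant for the projections, the forward decay and the backward decay\<close>
  define C where "C = Max {1 + 2 * D, (1 + c4) / c1\<^sup>2, 1 / d}"
  have C: "1 + 2 * D \<le> C" "(1 + c4) / c1\<^sup>2 \<le> C" "1 / d \<le> C" by (simp_all add: C_def)
  have "C > 0" using C(1) \<open>D \<ge> 0\<close> by linarith
  have bij: "bij_betw (evol B m n) (Xu n) (Xu m)" if "n \<le> m" for n m
    using inj_on_evol[OF Xu_subspace Xu_cone that] evol_image_Xu[OF that]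
    by (simp add: bij_betw_def)
  have commute: "evol B m n (Ps n v) = Ps m (evol B m n v)"
       "evol B m n (Pu n v) = Pu m (evol B m n v)" if "n \<le> m" for n m v
  proof -
    have sum: "evol B m n (Ps n v) + evol B m n (Pu n v) =
        Ps m (evol B m n v) + Pu m (evol B m n v)"
      by (metis P(3) blinfun.add_right)
    have "evol B m n (Ps n v) \<in> ?Xs m" "evol B m n (Pu n v) \<in> Xu m"
      using evol_growth_space[OF P(1) that] P(2) evol_image_Xu[OF that] by blast+
    then show "evol B m n (Ps n v) = Ps m (evol B m n v)"
       "evol B m n (Pu n v) = Pu m (evol B m n v)"
      using direct_sum_decomp_unique[OF direct_sum _ P(1) _ P(2) sum] by auto
  qed
  have st: "norm (evol B m n v) \<le> C * a ^ (m - n) * norm v" if "n \<le> m" "v \<in> ?Xs n" for n m v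
  proof -
    have "norm (evol B m n v) \<le> (1 + c4) / c1\<^sup>2 * a ^ (m - n) * norm v"
      using Vs_evol_norm growth_space_cone_orbit that by blast
    also have "\<dots> \<le> C * a ^ (m - n) * norm v"
      using C(2) ab by (intro mult_right_mono) auto
    finally show ?thesis .
  qed
  have un: "norm (inv_into (Xu n) (evol B m n) v) \<le> C * b powi (int n - int m) * norm v"
    if m: "n \<le> m" and v: "v \<in> Xu m" for n m v
  proof -
    define x where "x = inv_into (Xu n) (evol B m n) v"
    have x: "x \<in> Xu n" "evol B m n x = v"
      unfolding x_def using bij[OF m] v by (auto simp: bij_betw_def inv_into_into f_inv_into_f)
    have "d * b ^ (m - n) * norm x \<le> norm v"
      using Vu_evol_norm[OF m, of x] x Xu_cone by (auto simp: d_def)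
    then have "norm x \<le> 1 / d * (1 / b ^ (m - n)) * norm v"
      using \<open>d > 0\<close> b_pos by (simp add: field_simps)
    also have "\<dots> \<le> C * (1 / b ^ (m - n)) * norm v"
      using C(3) b_pos by (intro mult_right_mono) auto
    also have "1 / b ^ (m - n) = b powi (int n - int m)"
      using m b_pos by (auto simp: power_int_def inverse_eq_divide nat_diff_distrib' power_one_over
            simp flip: of_nat_diff)
    finally show ?thesis by (simp add: x_def)
  qed
  have norms: "norm (Ps n) + norm (Pu n) \<le> C" for n
    using P(4)[of n] C(1) by linarith
  show ?thesis
    unfolding exp_dichotomy_def
  proof (intro conjI ab allI direct_sum, rule exI[of _ Ps], rule exI[of _ Pu],
      intro conjI allI P, rule exI[of _ C])
  qed (use \<open>C > 0\<close> commute bij st un norms in \<open>auto intro!: blinfun_eqI\<close>)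
qed

end

theorem theorem1:
  fixes B :: "nat \<Rightarrow> 'a::banach \<Rightarrow>\<^sub>L 'a"
    and Iminus Iplus :: "nat \<Rightarrow> 'a \<Rightarrow> real"
    and \<alpha> :: "nat \<Rightarrow> nat \<Rightarrow> 'a \<Rightarrow>\<^sub>L real"
    and K :: nat
    and c1 c2 c3 c4 a b :: real
  assumes Iminus_nonneg: "\<And>n v. Iminus n v \<ge> 0"
    and Iplus_nonneg: "\<And>n v. Iplus n v \<ge> 0"
    and Iminus_cont: "\<And>n. continuous_on UNIV (Iminus n)"
    and Iplus_cont: "\<And>n. continuous_on UNIV (Iplus n)"
    and Iminus_hom: "\<And>n. homogeneous (Iminus n)"
    and Iplus_hom: "\<And>n. homogeneous (Iplus n)"
    and c_pos: "c1 > 0" "c2 > 0" "c3 > 0" "c4 > 0"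
    and ab: "0 < a" "a < b"
    and norm_equiv: "\<And>n v. c1 * norm v \<le> Iminus n v + Iplus n v \<and> Iminus n v + Iplus n v \<le> 1 / c1 * norm v"
    and Iplus_equiv: "\<And>n v. c2 * max_functional K \<alpha> n v \<le> Iplus n v \<and>
                         Iplus n v \<le> 1 / c2 * max_functional K \<alpha> n v"
    and cone_dim: "\<And>n. \<exists>L. subspace L \<and> has_dimension L K \<and> L \<subseteq> unstable_cone Iminus Iplus c3 n"
    and c4_small: "c4 < 1 / 3 * (c1 * c2)\<^sup>2 * (c3 / (1 + c3))"
    and contraction: "\<And>n v. B n v \<in> stable_cone Iminus Iplus c3 (Suc n) \<Longrightarrow>
                         Iminus (Suc n) (B n v) \<le> a * Iminus n v"
    and expansion: "\<And>n v. v \<in> unstable_cone Iminus Iplus c4 n \<Longrightarrow>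
                         Iplus (Suc n) (B n v) \<ge> b * Iplus n v"
  shows "has_exp_dichotomy B a b \<and>
         (\<forall>Xs Xu. exp_dichotomy B a b Xs Xu \<longrightarrow>
            (\<forall>n. Xs n \<subseteq> stable_cone Iminus Iplus c4 n \<and> has_codimension (Xs n) K))"
proof -
  interpret cone_system B Iminus Iplus \<alpha> K c1 c2 c3 c4 a b
    by unfold_locales fact+
  have "has_exp_dichotomy B a b" unfolding has_exp_dichotomy_def using dichotomy by blast
  moreover have "has_codimension (growth_space B a n) K" for n
    unfolding has_codimension_def using direct_sum Xu_dim by blast
  ultimately show ?thesis using growth_space_subset_Vs exp_dichotomy_stable_eq by metis
qed

end
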